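(* Let $n$ be an odd natural number, $h_n:=\frac{n-1}{2}$, and let $1\le \ell\le h_n$. For all $s,x\in\mathbb{R}^{n+1}$ with $|x|<|s|$ one has $$\mathcal{Q}_{c,s}^{-\ell}(x)=\sum_{k=2\ell-1}^{\infty}\mathcal{H}_\ell^k(x)\,s^{-k-1}.$$
   Context: $\mathbb{R}_n$ is the real Clifford algebra generated by $e_1,\dots,e_n$ with $e_ie_j+e_je_i=-2\delta_{ij}$. Elements of $\mathbb{R}^{n+1}$ are identified with paravectors $x=x_0+\underline{x}=x_0+\sum_{j=1}^n x_je_j\in\mathbb{R}_n$; $\bar x=x_0-\underline x$, $|x|^2=\sum_{j=0}^n x_j^2$. Products and inverses are taken in $\mathbb{R}_n$. $\mathcal{Q}_{c,s}(x):=s^2-2x_0s+|x|^2$ and $\mathcal{Q}_{c,s}^{-\ell}(x)$ is the $\ell$-th power of its inverse (it exists when $|x|<|s|$). For $\ell\ge1$ and $k\ge 2\ell-1$, $$\mathcal{H}_\ell^k(x):=\sum_{j=0}^{k-2\ell+1}\binom{\ell+j-1}{\ell-1}\binom{k-\ell-j}{\ell-1}x^{k-2\ell+1-j}\bar x^{\,j}.$$ *)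

theory Defs
  imports "HOL-Analysis.Analysis"
begin

section \<open>The real Clifford algebra with negative definite signature\<close>

text \<open>
  The generators are indexed by a finite, linearly ordered type \<open>'n\<close>, so the algebra
  \<open>\<real>\<^sub>n\<close> with \<open>n = CARD('n)\<close> is the type \<open>'n clifford\<close>.  An element is given by its \<open>2\<^sup>n\<close>
  coefficients with respect to the basis \<open>e\<^sub>A = e\<^bsub>i1\<^esub> \<cdots> e\<^bsub>ik\<^esub>\<close>, where
  \<open>A = {i1 < \<dots> < ik}\<close> runs through all subsets of \<open>'n\<close>.
\<close>

typedef ('n::finite) clifford = "UNIV :: (real ^ ('n set)) set"
  morphisms coeffs Clifford
  by simp

setup_lifting type_definition_clifford

text \<open>
  \<open>e\<^sub>A e\<^sub>B = reorder_sign A B \<cdot> e\<^bsub>A \<triangle> B\<^esub>\<close>: sorting the product costs one sign for every pair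
  \<open>b < a\<close> (from \<open>e\<^sub>a e\<^sub>b = - e\<^sub>b e\<^sub>a\<close>) and one sign for every common index (from \<open>e\<^sub>a\<^sup>2 = -1\<close>).
\<close>

definition reorder_sign :: "'n::{finite,linorder} set \<Rightarrow> 'n set \<Rightarrow> real" where
  "reorder_sign A B = (- 1) ^ card {(a, b). a \<in> A \<and> b \<in> B \<and> b \<le> a}"

lemma reorder_sign_prod:
  "reorder_sign A B = (\<Prod>a\<in>UNIV. \<Prod>b\<in>UNIV. if a \<in> A \<and> b \<in> B \<and> b \<le> a then - 1 else 1)"
proof -
  have "(\<Prod>a\<in>UNIV. \<Prod>b\<in>UNIV. if a \<in> A \<and> b \<in> B \<and> b \<le> a then - 1 else 1 :: real)
     = (\<Prod>p\<in>UNIV. if p \<in> {(a, b). a \<in> A \<and> b \<in> B \<and> b \<le> a} then - 1 else 1)"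
    by (subst prod.cartesian_product) (simp add: case_prod_unfold)
  also have "\<dots> = (\<Prod>p\<in>{(a, b). a \<in> A \<and> b \<in> B \<and> b \<le> a}. - 1)"
    by (subst prod.If_cases) auto
  finally show ?thesis
    by (simp add: reorder_sign_def)
qed

lemma reorder_sign_symdiff_left:
  "reorder_sign (sym_diff A B) C = reorder_sign A C * reorder_sign B C"
  unfolding reorder_sign_prod prod.distrib[symmetric]
  by (intro prod.cong refl) auto

lemma reorder_sign_symdiff_right:
  "reorder_sign A (sym_diff B C) = reorder_sign A B * reorder_sign A C"
  unfolding reorder_sign_prod prod.distrib[symmetric]
  by (intro prod.cong refl) auto

lemma reorder_sign_empty [simp]: "reorder_sign {} B = 1" "reorder_sign A {} = 1"
  by (simp_all add: reorder_sign_def)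

lemma sum_reindex_symdiff:
  fixes g :: "'n::finite set \<Rightarrow> 'b::comm_monoid_add"
  shows "(\<Sum>A\<in>UNIV. g (sym_diff B A)) = (\<Sum>A\<in>UNIV. g A)"
  by (rule sum.reindex_bij_witness[of _ "sym_diff B" "sym_diff B"]) auto

instantiation clifford :: (finite) real_normed_vector
begin

lift_definition zero_clifford :: "'a clifford" is 0 .
lift_definition plus_clifford :: "'a clifford \<Rightarrow> 'a clifford \<Rightarrow> 'a clifford" is "(+)" .
lift_definition minus_clifford :: "'a clifford \<Rightarrow> 'a clifford \<Rightarrow> 'a clifford" is "(-)" .
lift_definition uminus_clifford :: "'a clifford \<Rightarrow> 'a clifford" is uminus .
lift_definition scaleR_clifford :: "real \<Rightarrow> 'a clifford \<Rightarrow> 'a clifford" is "(*\<^sub>R)" .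
lift_definition norm_clifford :: "'a clifford \<Rightarrow> real" is norm .

definition dist_clifford :: "'a clifford \<Rightarrow> 'a clifford \<Rightarrow> real" where
  "dist_clifford a b = norm (a - b)"

definition sgn_clifford :: "'a clifford \<Rightarrow> 'a clifford" where
  "sgn_clifford a = inverse (norm a) *\<^sub>R a"

definition uniformity_clifford :: "('a clifford \<times> 'a clifford) filter" where
  "uniformity_clifford = (INF e\<in>{0 <..}. principal {(x, y). dist x y < e})"

definition open_clifford :: "'a clifford set \<Rightarrow> bool" where
  "open_clifford S = (\<forall>x\<in>S. \<forall>\<^sub>F (x', y) in uniformity. x' = x \<longrightarrow> y \<in> S)"

instance
  apply standard
  unfolding dist_clifford_def open_clifford_def sgn_clifford_def uniformity_clifford_def
  apply (rule refl | (transfer, force simp: norm_triangle_ineq algebra_simps))+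
  done

end

instantiation clifford :: ("{finite,linorder}") real_algebra_1
begin

lift_definition one_clifford :: "'a clifford" is "axis {} 1" .

lift_definition times_clifford :: "'a clifford \<Rightarrow> 'a clifford \<Rightarrow> 'a clifford" is
  "\<lambda>u v. \<chi> C. \<Sum>A\<in>UNIV. reorder_sign A (sym_diff A C) * (u $ A) * (v $ sym_diff A C)" .

instance
proof
  fix a b c :: "'a clifford" and r :: real
  show "(a * b) * c = a * (b * c)"
  proof (transfer, rule vec_eq_iff[THEN iffD2], rule allI)
    fix a b c :: "real ^ ('a set)" and D :: "'a set"
    let ?s = "reorder_sign :: 'a set \<Rightarrow> _"
    let ?t = "\<lambda>A B. ?s A B * ?s (sym_diff A B) (sym_diff (sym_diff A B) D) * a $ A * b $ B
                    * c $ sym_diff (sym_diff A B) D"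
    have s: "sym_diff A (sym_diff A B) = B" for A B :: "'a set" by auto
    have "(\<Sum>C\<in>UNIV. ?s C (sym_diff C D) * (\<Sum>A\<in>UNIV. ?s A (sym_diff A C) * a $ A * b $ sym_diff A C) * c $ sym_diff C D)
       = (\<Sum>A\<in>UNIV. \<Sum>C\<in>UNIV. ?s A (sym_diff A C) * ?s C (sym_diff C D) * a $ A * b $ sym_diff A C * c $ sym_diff C D)"
      by (subst sum.swap) (simp add: sum_distrib_left sum_distrib_right mult_ac)
    also have "\<dots> = (\<Sum>A\<in>UNIV. \<Sum>B\<in>UNIV. ?t A B)"
    proof (rule sum.cong[OF refl])
      fix A :: "'a set"
      show "(\<Sum>C\<in>UNIV. ?s A (sym_diff A C) * ?s C (sym_diff C D) * a $ A * b $ sym_diff A C * c $ sym_diff C D)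
          = (\<Sum>B\<in>UNIV. ?t A B)"
        by (subst sum_reindex_symdiff[of _ A, symmetric]) (simp only: s)
    qed
    also have "\<dots> = (\<Sum>A\<in>UNIV. \<Sum>B\<in>UNIV. ?s A (sym_diff A D) * a $ A *
             (?s B (sym_diff B (sym_diff A D)) * b $ B * c $ sym_diff B (sym_diff A D)))"
    proof (intro sum.cong refl)
      fix A B :: "'a set"
      define E where "E = sym_diff (sym_diff A B) D"
      have 1: "sym_diff B (sym_diff A D) = E" and 2: "sym_diff A D = sym_diff B E"
        by (auto simp: E_def)
      show "?t A B = ?s A (sym_diff A D) * a $ A *
             (?s B (sym_diff B (sym_diff A D)) * b $ B * c $ sym_diff B (sym_diff A D))"
        unfolding 1 E_def[symmetric] unfolding 2
        by (simp add: reorder_sign_symdiff_left reorder_sign_symdiff_right)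
    qed
    finally show "(\<chi> C. \<Sum>A\<in>UNIV. ?s A (sym_diff A C) * (\<chi> C. \<Sum>A\<in>UNIV. ?s A (sym_diff A C) * a $ A * b $ sym_diff A C) $ A * c $ sym_diff A C) $ D
        = (\<chi> C. \<Sum>A\<in>UNIV. ?s A (sym_diff A C) * a $ A * (\<chi> C. \<Sum>A\<in>UNIV. ?s A (sym_diff A C) * b $ A * c $ sym_diff A C) $ sym_diff A C) $ D"
      by (simp only: vec_lambda_beta sum_distrib_left)
  qed
  show "1 * a = a"
  proof (transfer, rule vec_eq_iff[THEN iffD2], rule allI)
    fix a :: "real ^ ('a set)" and C :: "'a set"
    have "(\<Sum>A\<in>UNIV. reorder_sign A (sym_diff A C) * axis {} 1 $ A * a $ sym_diff A C)
        = (\<Sum>A\<in>(UNIV :: 'a set set). if A = {} then a $ C else 0)"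
      by (intro sum.cong) (auto simp: axis_def)
    then show "(\<chi> C. \<Sum>A\<in>UNIV. reorder_sign A (sym_diff A C) * axis {} 1 $ A * a $ sym_diff A C) $ C = a $ C"
      by simp
  qed
  show "a * 1 = a"
  proof (transfer, rule vec_eq_iff[THEN iffD2], rule allI)
    fix a :: "real ^ ('a set)" and C :: "'a set"
    have "(\<Sum>A\<in>UNIV. reorder_sign A (sym_diff A C) * a $ A * axis {} 1 $ sym_diff A C)
        = (\<Sum>A\<in>UNIV. if A = C then a $ C else 0)"
      by (intro sum.cong) (auto simp: axis_def)
    then show "(\<chi> C. \<Sum>A\<in>UNIV. reorder_sign A (sym_diff A C) * a $ A * axis {} 1 $ sym_diff A C) $ C = a $ C"
      by simp
  qed
  show "(a + b) * c = a * c + b * c" "a * (b + c) = a * b + a * c"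
    by (transfer; simp add: vec_eq_iff algebra_simps sum.distrib)+
  show "(r *\<^sub>R a) * b = r *\<^sub>R (a * b)" "a * (r *\<^sub>R b) = r *\<^sub>R (a * b)"
    by (transfer; simp add: vec_eq_iff sum_distrib_left mult_ac)+
  show "(0 :: 'a clifford) \<noteq> 1"
    by transfer (metis axis_eq_0_iff zero_neq_one)
qed

end

text \<open>
  The algebra has zero divisors.  The inverse is the two-sided inverse of a unit, and \<open>0\<close> on
  non-units.  Through this instance \<open>x powi k\<close> is available for negative exponents.
\<close>

instantiation clifford :: ("{finite,linorder}") inverse
begin

definition inverse_clifford :: "'a clifford \<Rightarrow> 'a clifford" where
  "inverse_clifford a =
     (if \<exists>b. a * b = 1 \<and> b * a = 1 then THE b. a * b = 1 \<and> b * a = 1 else 0)"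

definition divide_clifford :: "'a clifford \<Rightarrow> 'a clifford \<Rightarrow> 'a clifford" where
  "divide_clifford a b = a * inverse b"

instance ..

end

lemma clifford_inverse_unique:
  fixes a b :: "'n::{finite,linorder} clifford"
  assumes "a * b = 1" "b * a = 1"
  shows "inverse a = b"
proof -
  have "(THE b. a * b = 1 \<and> b * a = 1) = b"
    using assms by (intro the_equality) (auto, metis mult.assoc mult_1_left mult_1_right)
  then show ?thesis
    using assms by (auto simp: inverse_clifford_def)
qed

lift_definition blade :: "'n::finite set \<Rightarrow> 'n clifford" is "\<lambda>A. axis A 1" .

definition gen :: "'n::finite \<Rightarrow> 'n clifford" where
  "gen i = blade {i}"

lemma blade_empty: "blade {} = 1"
  by transfer simp

lemma blade_mult:
  fixes A B :: "'n::{finite,linorder} set"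
  shows "blade A * blade B = reorder_sign A B *\<^sub>R blade (sym_diff A B)"
proof (transfer, rule vec_eq_iff[THEN iffD2], rule allI)
  fix A B C :: "'n::{finite,linorder} set"
  have "(\<Sum>X\<in>UNIV. reorder_sign X (sym_diff X C) * axis A 1 $ X * axis B 1 $ sym_diff X C)
     = (\<Sum>X\<in>UNIV. if X = A then reorder_sign A (sym_diff A C) * axis B 1 $ sym_diff A C else 0)"
    by (intro sum.cong) (auto simp: axis_def)
  also have "\<dots> = reorder_sign A (sym_diff A C) * axis B 1 $ sym_diff A C"
    by simp
  also have "\<dots> = reorder_sign A B * axis (sym_diff A B) 1 $ C"
  proof -
    have "sym_diff A C = B \<longleftrightarrow> C = sym_diff A B" by auto
    then show ?thesis by (auto simp: axis_def)
  qed
  finally show "(\<chi> C. \<Sum>X\<in>UNIV. reorder_sign X (sym_diff X C) * axis A 1 $ X * axis B 1 $ sym_diff X C) $ C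
       = (reorder_sign A B *\<^sub>R axis (sym_diff A B) 1) $ C"
    by simp
qed

lemma gen_anticommute:
  "gen i * gen j + gen j * gen i = (if i = j then - 2 else (0 :: 'n::{finite,linorder} clifford))"
proof (cases "i = j")
  case True
  have "{(a, b). a \<in> {j} \<and> b \<in> {j} \<and> b \<le> a} = {(j, j)}" by auto
  then have "gen j * gen j = (- 1 :: 'n clifford)"
    by (simp add: gen_def blade_mult reorder_sign_def blade_empty)
  then show ?thesis using True by simp
next
  case False
  have *: "reorder_sign {i} {j} = (if j \<le> i then - 1 else 1)" for i j :: 'n
  proof -
    have "{(a, b). a \<in> {i} \<and> b \<in> {j} \<and> b \<le> a} = (if j \<le> i then {(i, j)} else {})" by auto
    then show ?thesis by (simp add: reorder_sign_def)
  qed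
  have "sym_diff {i} {j} = sym_diff {j} {i}" by auto
  then show ?thesis using False
    by (auto simp: gen_def blade_mult *)
qed

lemma blade_insert:
  assumes "\<And>i. i \<in> A \<Longrightarrow> i < j"
  shows "blade (insert j A) = blade A * gen (j :: 'n::{finite,linorder})"
proof -
  have "{(a, b). a \<in> A \<and> b \<in> {j} \<and> b \<le> a} = {}" "sym_diff A {j} = insert j A"
    using assms by (auto dest: leD)
  then show ?thesis by (simp only: gen_def blade_mult reorder_sign_def) simp
qed

section \<open>Paravectors\<close>

text \<open>
  \<open>\<real>\<^sup>n\<^sup>+\<^sup>1\<close> is \<open>real \<times> real ^ 'n\<close>, a point being the pair of its scalar part \<open>x\<^sub>0\<close> and its vector
  part; the library norm on this type is \<open>\<bar>x\<bar>\<close>.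
\<close>

type_synonym 'n paravector = "real \<times> (real, 'n) vec"

definition para :: "'n::{finite,linorder} paravector \<Rightarrow> 'n clifford" where
  "para x = of_real (fst x) + (\<Sum>j\<in>UNIV. (snd x $ j) *\<^sub>R gen j)"

definition para_cnj :: "'n::finite paravector \<Rightarrow> 'n paravector" where
  "para_cnj x = (fst x, - snd x)"

definition Q_c :: "'n::{finite,linorder} paravector \<Rightarrow> 'n paravector \<Rightarrow> 'n clifford" where
  "Q_c s x = para s ^ 2 - of_real (2 * fst x) * para s + of_real ((norm x)\<^sup>2)"

text \<open>
  Only used for \<open>l \<ge> 1\<close> and \<open>k \<ge> 2 * l - 1\<close>, where no subtraction on \<open>nat\<close> truncates.  The
  bound \<open>k - 2\<ell> + 1\<close> is written \<open>k + 1 - 2 * l\<close> since \<open>k - 2 * l\<close> would truncate for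
  \<open>k = 2 * l - 1\<close>.
\<close>

definition H_poly :: "nat \<Rightarrow> nat \<Rightarrow> 'n::{finite,linorder} paravector \<Rightarrow> 'n clifford" where
  "H_poly l k x =
     (\<Sum>j = 0..k + 1 - 2 * l.
        of_nat (((l + j - 1) choose (l - 1)) * ((k - l - j) choose (l - 1)))
          * para x ^ (k + 1 - 2 * l - j) * para (para_cnj x) ^ j)"

subsection \<open>Well-definedness of the inverse powers\<close>

lemma vec_square:
  fixes v :: "real ^ 'n::{finite,linorder}"
  shows "(\<Sum>j\<in>UNIV. v $ j *\<^sub>R gen j) * (\<Sum>j\<in>UNIV. v $ j *\<^sub>R gen j) = - of_real ((norm v)\<^sup>2)"
proof -
  let ?V = "\<Sum>j\<in>UNIV. v $ j *\<^sub>R gen j"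
  let ?f = "\<lambda>i j. (v $ i * v $ j) *\<^sub>R (gen i * gen j :: 'n clifford)"
  have VV: "?V * ?V = (\<Sum>i\<in>UNIV. \<Sum>j\<in>UNIV. ?f i j)"
    by (simp add: sum_product mult.commute[where 'a = real])
  then have VV': "?V * ?V = (\<Sum>i\<in>UNIV. \<Sum>j\<in>UNIV. ?f j i)"
    by (subst sum.swap)
  have "?V * ?V + ?V * ?V = (\<Sum>i\<in>UNIV. \<Sum>j\<in>UNIV. ?f i j) + (\<Sum>i\<in>UNIV. \<Sum>j\<in>UNIV. ?f j i)"
    by (rule arg_cong2[where f = "(+)", OF VV VV'])
  also have "\<dots> = (\<Sum>i\<in>UNIV. \<Sum>j\<in>UNIV. (v $ i * v $ j) *\<^sub>R (gen i * gen j + gen j * gen i :: 'n clifford))"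
    by (simp add: sum.distrib[symmetric] scaleR_add_right mult.commute)
  also have "\<dots> = (\<Sum>i\<in>UNIV. \<Sum>j\<in>UNIV. if i = j then (v $ i * v $ i) *\<^sub>R (- 2) else 0)"
    by (intro sum.cong refl) (simp add: gen_anticommute)
  also have "\<dots> = (\<Sum>i\<in>UNIV. v $ i * v $ i) *\<^sub>R (- 2)"
    by (simp add: scaleR_sum_left sum_negf)
  also have "(\<Sum>i\<in>UNIV. v $ i * v $ i) = (norm v)\<^sup>2"
    by (simp add: power2_norm_eq_inner inner_vec_def)
  finally have "2 *\<^sub>R (?V * ?V) = (norm v)\<^sup>2 *\<^sub>R (- 2 :: 'n clifford)"
    by (simp add: scaleR_2)
  also have "\<dots> = 2 *\<^sub>R (- of_real ((norm v)\<^sup>2))"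
  proof -
    have two: "(2 :: 'n clifford) = 2 *\<^sub>R 1"
      by (simp add: scaleR_2)
    show ?thesis
      unfolding two of_real_def by (simp)
  qed
  finally show ?thesis
    by (rule scaleR_left_imp_eq[rotated]) simp
qed

lemma para_conv: "para (a, v) = of_real a + (\<Sum>j\<in>UNIV. v $ j *\<^sub>R gen j)"
  by (simp add: para_def)

lemma para_cnj_conv: "para (para_cnj (a, v)) = of_real a - (\<Sum>j\<in>UNIV. v $ j *\<^sub>R gen j)"
  by (simp add: para_def para_cnj_def sum_negf)

lemma para_mult_cnj:
  fixes x :: "'n::{finite,linorder} paravector"
  shows "para x * para (para_cnj x) = of_real ((norm x)\<^sup>2)"
    and "para (para_cnj x) * para x = of_real ((norm x)\<^sup>2)"
proof -
  obtain a v where x: "x = (a, v)" by (cases x)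
  have nx: "(norm x)\<^sup>2 = a\<^sup>2 + (norm v)\<^sup>2"
    by (simp add: x norm_Pair)
  have *: "(of_real a + W) * (of_real a - W) = of_real (a\<^sup>2 + M)"
      "(of_real a - W) * (of_real a + W) = of_real (a\<^sup>2 + M)"
    if "W * W = - of_real M" for W :: "'n clifford" and M :: real
    using that by (simp_all add: of_real_def power2_eq_square algebra_simps)
  show "para x * para (para_cnj x) = of_real ((norm x)\<^sup>2)"
       "para (para_cnj x) * para x = of_real ((norm x)\<^sup>2)"
    unfolding nx unfolding x para_conv para_cnj_conv
    by (rule *[OF vec_square])+
qed

lemma para_inverse:
  assumes "x \<noteq> 0"
  shows "para x * ((1 / (norm x)\<^sup>2) *\<^sub>R para (para_cnj x)) = 1"
        "((1 / (norm x)\<^sup>2) *\<^sub>R para (para_cnj x)) * para x = 1"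
  using assms by (simp_all add: para_mult_cnj of_real_def)

lemma para_invertible:
  assumes "s \<noteq> 0"
  shows "para s * inverse (para s) = 1" "inverse (para s) * para s = 1"
  unfolding clifford_inverse_unique[OF para_inverse[OF assms]]
  by (rule para_inverse[OF assms])+

lemma Q_c_paravector:
  fixes s x :: "'n::{finite,linorder} paravector"
  shows "Q_c s x = para (2 * (fst s - fst x) * fst s + (norm x)\<^sup>2 - (norm s)\<^sup>2,
                   (2 * (fst s - fst x)) *\<^sub>R snd s)"
proof -
  obtain a v where s: "s = (a, v)" by (cases s)
  let ?V = "\<Sum>j\<in>UNIV. v $ j *\<^sub>R gen j"
  have 1: "(\<Sum>j\<in>UNIV. ((2 * (a - fst x)) *\<^sub>R v) $ j *\<^sub>R gen j) = (2 * (a - fst x)) *\<^sub>R ?V"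
    by (simp add: scaleR_sum_right)
  have 2: "(norm s)\<^sup>2 = a\<^sup>2 + (norm v)\<^sup>2"
    by (simp add: s norm_Pair)
  have 3: "(of_real a + W)\<^sup>2 - of_real (2 * f) * (of_real a + W) + of_real N
      = of_real (2 * (a - f) * a + N - (a\<^sup>2 + M)) + (2 * (a - f)) *\<^sub>R W"
    if "W * W = - of_real M" for W :: "'n clifford" and f N M :: real
    using that scaleR_left_distrib[of a a W]
    by (simp add: of_real_def power2_eq_square algebra_simps)
  show ?thesis
    unfolding Q_c_def 2 unfolding s para_conv fst_conv snd_conv 1
    by (rule 3[OF vec_square])
qed

lemma Q_c_invertible:
  assumes "norm x < norm s"
  shows "Q_c s x * inverse (Q_c s x) = 1" "inverse (Q_c s x) * Q_c s x = 1"
proof -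
  let ?y = "(2 * (fst s - fst x) * fst s + (norm x)\<^sup>2 - (norm s)\<^sup>2, (2 * (fst s - fst x)) *\<^sub>R snd s)"
  have "?y \<noteq> 0"
  proof
    assume "?y = 0"
    then have y: "2 * (fst s - fst x) * fst s + (norm x)\<^sup>2 - (norm s)\<^sup>2 = 0"
        "fst s = fst x \<or> snd s = 0"
      by (auto simp: zero_prod_def)
    have lt: "(norm x)\<^sup>2 < (norm s)\<^sup>2"
      using assms by (simp add: power_strict_mono)
    have ns: "(norm s)\<^sup>2 = (fst s)\<^sup>2 + (norm (snd s))\<^sup>2" and nx: "(fst x)\<^sup>2 \<le> (norm x)\<^sup>2"
      by (cases s; simp add: norm_Pair) (cases x; simp add: norm_Pair)
    from y lt have "snd s = 0" "fst s \<noteq> fst x" by auto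
    then have "(fst s - fst x)\<^sup>2 > 0" and "(norm s)\<^sup>2 = (fst s)\<^sup>2" using ns by auto
    then show False using y(1) nx by (simp add: power2_eq_square algebra_simps)
  qed
  from para_invertible[OF this]
  show "Q_c s x * inverse (Q_c s x) = 1" "inverse (Q_c s x) * Q_c s x = 1"
    unfolding Q_c_paravector .
qed

end

theory Submission
  imports Defs
begin

text \<open>
  Every paravector lies in a copy \<open>\<real> + I\<real>\<close> of \<open>\<complex>\<close> inside \<open>\<real>\<^sub>n\<close>, where \<open>I\<^sup>2 = -1\<close>.  The paravectors
  \<open>s\<close> and \<open>x\<close> need not commute and lie in different copies, but the sum defining \<open>\<H>\<^sub>\<ell>\<^sup>k(x)\<close> is
  symmetric in \<open>x\<close> and its conjugate, hence real.  So the claim takes place in the copy of \<open>\<complex>\<close>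
  containing \<open>s\<close>.  There it says \<open>((w - z) (w - cnj z))\<^bsup>-\<ell>\<^esup> = \<Sum>\<^sub>k \<H>\<^sub>\<ell>\<^sup>k(z) w\<^bsup>-k-1\<^esup>\<close>, which is the
  Cauchy product of the two binomial series in \<open>z/w\<close> and \<open>cnj z/w\<close>.
\<close>

definition complex_emb :: "'a::real_algebra_1 \<Rightarrow> complex \<Rightarrow> 'a" where
  "complex_emb I z = Re z *\<^sub>R 1 + Im z *\<^sub>R I"

text \<open>Continuity lets a convergent complex series be mapped termwise into the Clifford
  algebra.\<close>

lemma bounded_linear_complex_emb:
  fixes I :: "'n::{finite,linorder} clifford"
  shows "bounded_linear (complex_emb I)"
  unfolding complex_emb_def
  by (intro bounded_linear_add bounded_linear_scaleR_const bounded_linear_Re bounded_linear_Im)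

lemma complex_emb_add: "complex_emb I (z + w) = complex_emb I z + complex_emb I w"
  by (simp add: complex_emb_def scaleR_add_left)

lemma complex_emb_minus: "complex_emb I (z - w) = complex_emb I z - complex_emb I w"
  by (simp add: complex_emb_def scaleR_diff_left)

lemma complex_emb_sum: "complex_emb I (sum f A) = (\<Sum>j\<in>A. complex_emb I (f j))"
  by (simp add: complex_emb_def scaleR_sum_left sum.distrib)

lemma complex_emb_of_real: "complex_emb I (of_real r) = of_real r"
  by (simp add: complex_emb_def of_real_def)

lemma complex_emb_of_nat: "complex_emb I (of_nat k) = of_nat k"
  using complex_emb_of_real[of I "real k"] by simp

lemma complex_emb_one: "complex_emb I 1 = 1"
  by (simp add: complex_emb_def)

lemma complex_emb_mult:
  assumes "I * I = -1"
  shows "complex_emb I (z * w) = complex_emb I z * complex_emb I w"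
  using assms by (simp add: complex_emb_def algebra_simps)

lemma complex_emb_power:
  assumes "I * I = -1"
  shows "complex_emb I (z ^ k) = complex_emb I z ^ k"
  by (induction k) (simp_all add: complex_emb_mult[OF assms] complex_emb_one)

lemma complex_emb_inverse:
  fixes I :: "'n::{finite,linorder} clifford"
  assumes "I * I = -1" and "z \<noteq> 0"
  shows "complex_emb I (inverse z) = inverse (complex_emb I z)"
  using assms
  by (intro clifford_inverse_unique[symmetric])
     (simp_all add: complex_emb_mult[symmetric] complex_emb_one)

lemma complex_emb_power_int:
  fixes I :: "'n::{finite,linorder} clifford"
  assumes "I * I = -1" and "z \<noteq> 0"
  shows "complex_emb I (z powi k) = complex_emb I z powi k"
  using assms by (simp add: power_int_def complex_emb_power complex_emb_inverse)

text \<open>With the vector part written as \<open>b\<close> times a unit vector \<open>u\<close>,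
  take for \<open>I\<close> the element with coordinates \<open>u\<close>: its square is minus the
  squared norm of \<open>u\<close>.\<close>

lemma paravector_complex_emb:
  fixes x :: "'n::{finite,linorder} paravector"
  obtains I z where "I * I = -1" "para x = complex_emb I z"
    "para (para_cnj x) = complex_emb I (cnj z)" "Re z = fst x" "cmod z = norm x"
proof -
  obtain a v where x: "x = (a, v)" by (cases x)
  obtain u b where u: "norm u = 1" and v: "v = b *\<^sub>R u"
  proof (cases "v = 0")
    case True
    \<comment> \<open>A zero vector part has no direction, so any unit vector serves, with
      \<open>b = 0\<close>.\<close>
    then show ?thesis
      using that[of "axis undefined 1" 0] by simp
  next
    case False
    then show ?thesis
      using that[of "sgn v" "norm v"] by (simp add: norm_sgn sgn_div_norm)
  qed
  define I where "I = (\<Sum>j\<in>UNIV. u $ j *\<^sub>R gen j :: 'n clifford)"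
  have "I * I = -1"
    using vec_square[of u] u by (simp add: I_def)
  moreover have V: "(\<Sum>j\<in>UNIV. v $ j *\<^sub>R gen j) = b *\<^sub>R I"
    by (simp add: I_def v scaleR_sum_right)
  ultimately show ?thesis
    using u
    by (intro that[of I "Complex a b"])
       (simp_all add: x para_conv para_cnj_conv V complex_emb_def of_real_def cmod_def norm_Pair v)
qed

text \<open>Induction on \<open>l\<close>, multiplying by the geometric series. Absolute summability
  is carried along because the Cauchy product requires it.\<close>

lemma negative_binomial_sums:
  fixes u :: "'a::{real_normed_field,banach}"
  assumes "norm u < 1"
  shows "(\<lambda>j. of_nat ((l + j) choose l) * u ^ j) sums inverse (1 - u) ^ Suc l
    \<and> summable (\<lambda>j. norm (of_nat ((l + j) choose l) * u ^ j))"
proof (induction l)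
  case 0
  show ?case
    using assms geometric_sums[OF assms] by (simp add: norm_power divide_inverse)
next
  case (Suc l)
  let ?f = "\<lambda>l j. of_nat ((l + j) choose l) * u ^ j"
  have geom: "summable (\<lambda>j. norm (u ^ j))" "(\<Sum>j. u ^ j) = inverse (1 - u)"
    using assms suminf_geometric[OF assms] by (simp_all add: norm_power divide_inverse)
  have IH: "summable (\<lambda>j. norm (?f l j))" "(\<Sum>j. ?f l j) = inverse (1 - u) ^ Suc l"
    using Suc by (auto simp: sums_iff)
  have conv: "(\<Sum>i\<le>k. ?f l i * u ^ (k - i)) = ?f (Suc l) k" for k
  proof -
    have "(\<Sum>i\<le>k. ?f l i * u ^ (k - i)) = (\<Sum>i\<le>k. of_nat ((l + i) choose l)) * u ^ k"
      by (auto simp: sum_distrib_right mult.assoc power_add[symmetric] intro!: sum.cong)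
    also have "(\<Sum>i\<le>k. of_nat ((l + i) choose l) :: 'a) = of_nat (\<Sum>i\<le>k. (l + i) choose i)"
      by (simp add: binomial_symmetric[of l "l + _"])
    \<comment> \<open>The hockey-stick identity.\<close>
    also have "(\<Sum>i\<le>k. (l + i) choose i) = (Suc l + k) choose Suc l"
      using binomial_symmetric[of k "Suc (l + k)"]
      by (simp add: sum_choose_lower Suc_diff_le del: binomial_Suc_Suc)
    finally show ?thesis .
  qed
  have "(\<lambda>k. \<Sum>i\<le>k. ?f l i * u ^ (k - i)) sums ((\<Sum>j. ?f l j) * (\<Sum>j. u ^ j))"
    by (rule Cauchy_product_sums[OF IH(1) geom(1)])
  then have sums: "?f (Suc l) sums inverse (1 - u) ^ Suc (Suc l)"
    unfolding conv IH(2) geom(2) by (simp only: power_Suc2)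
  \<comment> \<open>The Cauchy product of the norms dominates the new terms by the triangle
    inequality.\<close>
  have "summable (\<lambda>k. \<Sum>i\<le>k. norm (?f l i) * norm (u ^ (k - i)))"
    using summable_Cauchy_product[of "\<lambda>j. norm (?f l j)" "\<lambda>j. norm (u ^ j)"] IH(1) geom(1) by simp
  moreover have "(\<Sum>i\<le>k. norm (?f l i) * norm (u ^ (k - i))) \<ge> norm (?f (Suc l) k)" for k
    unfolding conv[symmetric] by (metis (no_types, lifting) norm_mult norm_sum sum.cong)
  ultimately have "summable (\<lambda>k. norm (?f (Suc l) k))"
    by - (rule summable_comparison_test'[where N = 0], assumption, simp only: real_norm_def abs_norm_cancel)
  with sums show ?case by blast
qed

text \<open>The complex counterpart of \<open>H_poly (Suc l) (2 * Suc l - 1 + m)\<close>. Indexing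
  by the degree \<open>m\<close> leaves only the subtraction \<open>m - j\<close>, which never
  truncates.\<close>

definition H_complex :: "nat \<Rightarrow> nat \<Rightarrow> complex \<Rightarrow> complex" where
  "H_complex l m z = (\<Sum>j\<le>m. of_nat (((l + j) choose l) * ((l + (m - j)) choose l))
     * z ^ (m - j) * cnj z ^ j)"

text \<open>The reflection of \<open>j\<close> to \<open>m - j\<close> undoes conjugation: the
  powers of \<open>z\<close> and \<open>cnj z\<close> trade places, and so do the two binomial
  coefficients.\<close>

lemma H_complex_real: "H_complex l m z = of_real (Re (H_complex l m z))"
proof -
  have "cnj (H_complex l m z) = H_complex l m z"
    unfolding H_complex_def cnj_sum
    by (rule sum.reindex_bij_witness[of _ "\<lambda>j. m - j" "\<lambda>j. m - j"]) (auto simp: mult_ac)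
  then show ?thesis
    by (metis Reals_cnj_iff of_real_Re)
qed

lemma H_complex_sums:
  assumes "cmod z < cmod w"
  shows "(\<lambda>m. H_complex l m z * inverse w ^ (2 * Suc l + m))
    sums inverse (w\<^sup>2 - of_real (2 * Re z) * w + of_real ((cmod z)\<^sup>2)) ^ Suc l"
proof -
  have w: "w \<noteq> 0" using assms by auto
  let ?f = "\<lambda>z j. of_nat ((l + j) choose l) * (z / w) ^ j"
  have nb: "summable (\<lambda>j. norm (?f y j))" "(\<Sum>j. ?f y j) = inverse (1 - y / w) ^ Suc l"
    if "cmod y = cmod z" for y
    using negative_binomial_sums[of "y / w" l] assms w that
    by (auto simp: sums_iff norm_divide divide_less_eq)
  have "(\<lambda>m. \<Sum>j\<le>m. ?f (cnj z) j * ?f z (m - j)) sums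
      (inverse (1 - cnj z / w) ^ Suc l * inverse (1 - z / w) ^ Suc l)"
    using Cauchy_product_sums[OF nb(1)[of "cnj z"] nb(1)[of z]] nb(2)[of "cnj z"] nb(2)[of z] by simp
  moreover have "(\<Sum>j\<le>m. ?f (cnj z) j * ?f z (m - j)) = H_complex l m z * inverse w ^ m" for m
    unfolding H_complex_def sum_distrib_right
  proof (intro sum.cong refl)
    fix j assume "j \<in> {..m}"
    then have "inverse w ^ m = inverse w ^ j * inverse w ^ (m - j)"
      by (simp add: power_add[symmetric])
    then show "?f (cnj z) j * ?f z (m - j) = of_nat (((l + j) choose l) * ((l + (m - j)) choose l))
        * z ^ (m - j) * cnj z ^ j * inverse w ^ m"
      by (simp add: divide_inverse power_mult_distrib mult_ac)
  qed
  \<comment> \<open>The prefactor supplies one \<open>inverse w ^ Suc l\<close> to each factor,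
    turning \<open>1 - z / w\<close> into \<open>w - z\<close> and likewise for
    \<open>cnj z\<close>.\<close>
  ultimately have "(\<lambda>m. inverse w ^ (2 * Suc l) * (H_complex l m z * inverse w ^ m)) sums
      (inverse w ^ (2 * Suc l) * (inverse (1 - cnj z / w) ^ Suc l * inverse (1 - z / w) ^ Suc l))"
    by (intro sums_mult) simp
  moreover have "inverse w ^ (2 * Suc l) * (inverse (1 - cnj z / w) ^ Suc l * inverse (1 - z / w) ^ Suc l)
      = inverse (w\<^sup>2 - of_real (2 * Re z) * w + of_real ((cmod z)\<^sup>2)) ^ Suc l"
  proof -
    have "w\<^sup>2 * ((1 - cnj z / w) * (1 - z / w)) = w\<^sup>2 - (z + cnj z) * w + z * cnj z"
      using w by (simp add: power2_eq_square field_simps)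
    also have "\<dots> = w\<^sup>2 - of_real (2 * Re z) * w + of_real ((cmod z)\<^sup>2)"
      by (simp only: complex_add_cnj complex_norm_square)
    finally show ?thesis
      by (simp only: power_mult power_mult_distrib[symmetric] inverse_mult_distrib[symmetric]
          power_inverse)
  qed
  ultimately show ?thesis
    by (simp only: power_add mult_ac)
qed

text \<open>The roots in \<open>w\<close> are \<open>z\<close> and \<open>cnj z\<close>, both of
  modulus smaller than that of \<open>w\<close>.\<close>

lemma complex_Q_nonzero:
  assumes "cmod z < cmod w"
  shows "w\<^sup>2 - of_real (2 * Re z) * w + of_real ((cmod z)\<^sup>2) \<noteq> 0"
proof -
  have "w\<^sup>2 - of_real (2 * Re z) * w + of_real ((cmod z)\<^sup>2) = w\<^sup>2 - (z + cnj z) * w + z * cnj z"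
    by (simp only: complex_add_cnj complex_norm_square)
  also have "\<dots> = (w - z) * (w - cnj z)"
    by (simp add: power2_eq_square algebra_simps)
  finally show ?thesis using assms by auto
qed

text \<open>The value no longer mentions \<open>I\<close>, so it can be moved from the copy
  containing \<open>x\<close> to any other.\<close>

lemma H_poly_complex:
  assumes "I * I = -1" "para x = complex_emb I z" "para (para_cnj x) = complex_emb I (cnj z)"
  shows "H_poly (Suc l) (2 * Suc l - 1 + m) x = of_real (Re (H_complex l m z))"
proof -
  have "H_poly (Suc l) (2 * Suc l - 1 + m) x = complex_emb I (H_complex l m z)"
    unfolding H_poly_def H_complex_def complex_emb_sum complex_emb_mult[OF assms(1)]
      complex_emb_power[OF assms(1)] complex_emb_of_nat assms(2,3)
    by (intro sum.cong) auto
  then show ?thesis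
    by (metis H_complex_real complex_emb_of_real)
qed

theorem theorem5p10:
  fixes n l :: nat
    and s x :: "'n::{finite,linorder} paravector"
  assumes "n = CARD('n)"
    and "odd n"
    and "1 \<le> l" and "l \<le> (n - 1) div 2"
    and "norm x < norm s"
  shows "(\<lambda>m. let k = 2 * l - 1 + m in H_poly l k x * para s powi (- int k - 1))
           sums (Q_c s x powi (- int l))"
proof -
  obtain l' where l: "l = Suc l'" using assms(3) by (cases l) auto
  obtain J z where J: "J * J = (-1 :: 'n clifford)" "para x = complex_emb J z"
    "para (para_cnj x) = complex_emb J (cnj z)" and z: "Re z = fst x" "cmod z = norm x"
    by (rule paravector_complex_emb)
  obtain I w where I: "I * I = (-1 :: 'n clifford)" "para s = complex_emb I w"
    and w: "cmod w = norm s"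
    by (rule paravector_complex_emb)
  have less: "cmod z < cmod w" using assms(5) by (simp add: z w)
  then have w0: "w \<noteq> 0" by auto
  let ?Q = "w\<^sup>2 - of_real (2 * Re z) * w + of_real ((cmod z)\<^sup>2)"
  \<comment> \<open>\<open>Q_c\<close> depends on \<open>x\<close> only through two real numbers,
    hence lies in the copy of \<open>s\<close>.\<close>
  have "Q_c s x = complex_emb I ?Q"
    by (simp only: Q_c_def I(2) z complex_emb_add complex_emb_minus complex_emb_mult[OF I(1)]
        complex_emb_power[OF I(1)] complex_emb_of_real)
  then have Q: "Q_c s x powi (- int l) = complex_emb I (inverse ?Q ^ Suc l')"
    by (simp only: complex_emb_power_int[OF I(1) complex_Q_nonzero[OF less], symmetric]
        power_int_minus power_int_of_nat l power_inverse)
  have H: "(let k = 2 * l - 1 + m in H_poly l k x * para s powi (- int k - 1))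
      = complex_emb I (H_complex l' m z * inverse w ^ (2 * Suc l' + m))" for m
  proof -
    have k: "- int (2 * l - 1 + m) - 1 = - int (2 * Suc l' + m)" by (simp add: l)
    \<comment> \<open>Change of copy: \<open>z\<close> belongs to \<open>J\<close>, but the real
      value is embedded identically by \<open>I\<close>.\<close>
    have "complex_emb I (H_complex l' m z) = H_poly l (2 * l - 1 + m) x"
      by (metis l H_poly_complex[OF J] H_complex_real complex_emb_of_real)
    then show ?thesis
      unfolding Let_def k I(2) complex_emb_mult[OF I(1)]
      by (simp only: complex_emb_power_int[OF I(1) w0, symmetric] power_int_minus power_int_of_nat
          power_inverse)
  qed
  show ?thesis
    unfolding H Q
    by (rule bounded_linear.sums[OF bounded_linear_complex_emb H_complex_sums[OF less]])
qed

end
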